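(* Let $k\in\mathbb{N}$, let $d$ be the metric on $\mathbb{R}^k$ induced by a norm $\|\cdot\|$, let $r\in(0,\infty)$, let $S$ be a nonempty closed subset of $\mathbb{R}^k$, and let $P$ be a Borel probability measure on $\mathbb{R}^k$ with $\int d(x,0)^r\,dP(x)<\infty$. Then an optimal set of one-point for $P$ with respect to the constraint $S$ always exists, i.e., $\mathcal{C}_{1,r}(P;S)$ is nonempty.
   Context: For a finite nonempty $\alpha\subseteq S$, $V_r(P;\alpha)=\int \min_{a\in\alpha} d(x,a)^r\,dP(x)$, and $V_{n,r}(P)=\inf\{V_r(P;\alpha):\alpha\subseteq S,\ 1\le \mathrm{card}(\alpha)\le n\}$. An optimal set of $n$-points for $P$ with respect to the constraint $S$ is a set $\alpha\subseteq S$ with $1\le\mathrm{card}(\alpha)\le n$ and $V_r(P;\alpha)=V_{n,r}(P)$. $\mathcal{C}_{n,r}(P;S)$ denotes the collection of all optimal sets of $n$-points for $P$ with respect to $S$. *)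

theory Defs
  imports "HOL-Probability.Probability"
begin

text \<open>
  The type \<^typ>\<open>real ^ 'k\<close> carries the Euclidean norm as its class instance, so an arbitrary
  norm is given as a function. Nonnegativity follows from the three conditions, as in the
  class \<^class>\<open>real_normed_vector\<close>.
\<close>

definition is_norm :: "('a::real_vector \<Rightarrow> real) \<Rightarrow> bool" where
  "is_norm N \<longleftrightarrow>
     (\<forall>x. N x = 0 \<longleftrightarrow> x = 0) \<and>
     (\<forall>x y. N (x + y) \<le> N x + N y) \<and>
     (\<forall>c x. N (c *\<^sub>R x) = \<bar>c\<bar> * N x)"

definition norm_metric :: "('a::real_vector \<Rightarrow> real) \<Rightarrow> 'a \<Rightarrow> 'a \<Rightarrow> real" where
  "norm_metric N x y = N (x - y)"

text \<open>
  Integrals of the nonnegative functions below are taken in \<open>[0,\<infinity>]\<close>, so that a divergent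
  integral is \<open>\<infinity>\<close> and not a default value. The minimum is meaningful only for finite
  nonempty \<open>A\<close>. For \<open>r > 0\<close> we have \<open>0 powr r = 0\<close>, as needed when \<open>x\<close> lies in \<open>A\<close>.
\<close>

definition distortion :: "('a \<Rightarrow> 'a \<Rightarrow> real) \<Rightarrow> real \<Rightarrow> 'a measure \<Rightarrow> 'a set \<Rightarrow> ennreal" where
  "distortion d r P A = (\<integral>\<^sup>+ x. ennreal (MIN a\<in>A. d x a powr r) \<partial>P)"

text \<open>The bound \<open>1 \<le> card A\<close> makes \<open>A\<close> finite and nonempty, since infinite sets have \<open>card A = 0\<close>.\<close>

definition quantization_error ::
    "('a \<Rightarrow> 'a \<Rightarrow> real) \<Rightarrow> real \<Rightarrow> 'a measure \<Rightarrow> 'a set \<Rightarrow> nat \<Rightarrow> ennreal" where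
  "quantization_error d r P S n =
     (INF A\<in>{A. A \<subseteq> S \<and> 1 \<le> card A \<and> card A \<le> n}. distortion d r P A)"

definition optimal_sets ::
    "('a \<Rightarrow> 'a \<Rightarrow> real) \<Rightarrow> real \<Rightarrow> 'a measure \<Rightarrow> 'a set \<Rightarrow> nat \<Rightarrow> 'a set set" where
  "optimal_sets d r P S n =
     {A. A \<subseteq> S \<and> 1 \<le> card A \<and> card A \<le> n \<and>
         distortion d r P A = quantization_error d r P S n}"

end

theory Submission
  imports Defs "HOL-Real_Asymp.Real_Asymp"
begin

text \<open>
  Take a minimizing sequence of centers in \<open>S\<close>. If it has a bounded subsequence, a limit point of
  it lies in \<open>S\<close> and is optimal by Fatou's lemma. Otherwise its norms tend to infinity, and
  Fatou's lemma shows that the infimum is \<open>\<infinity>\<close>, so that every point of \<open>S\<close> is optimal.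
\<close>

text \<open>The triangle inequality for \<open>x\<close> and \<open>-x\<close> gives 0 \<le> 2 *
  \<open>N x\<close>.\<close>

lemma is_norm_nonneg:
  assumes "is_norm N"
  shows "0 \<le> N x"
proof -
  have "N (x + (-1) *\<^sub>R x) \<le> N x + N ((-1) *\<^sub>R x)" "N ((-1) *\<^sub>R x) = \<bar>-1\<bar> * N x" "N 0 = 0"
    using assms unfolding is_norm_def by blast+
  then show ?thesis by simp
qed

text \<open>Homogeneity and the triangle inequality make \<open>N\<close> convex, and a convex
  function on a finite-dimensional space is continuous. Continuity refers to the Euclidean topology
  of the type, in which closedness and compactness are also understood.\<close>

lemma continuous_on_is_norm:
  fixes N :: "'a::euclidean_space \<Rightarrow> real"
  assumes "is_norm N"
  shows "continuous_on A N"
proof -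
  have "convex_on UNIV N"
  proof (rule convex_onI)
    fix t x y assume t: "0 < t" "t < (1::real)"
    have "N ((1 - t) *\<^sub>R x + t *\<^sub>R y) \<le> N ((1 - t) *\<^sub>R x) + N (t *\<^sub>R y)"
      using assms unfolding is_norm_def by blast
    also have "\<dots> = \<bar>1 - t\<bar> * N x + \<bar>t\<bar> * N y"
      using assms unfolding is_norm_def by presburger
    finally show "N ((1 - t) *\<^sub>R x + t *\<^sub>R y) \<le> (1 - t) * N x + t * N y"
      using t by simp
  qed simp
  then have "continuous_on UNIV N"
    by (intro convex_on_continuous) auto
  then show ?thesis
    by (rule continuous_on_subset) simp
qed

text \<open>The constant is the minimum of \<open>N\<close> on the Euclidean unit sphere: it is
  attained by compactness, positive by definiteness, and homogeneity carries the bound to all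
  vectors. It serves to transfer divergence of Euclidean norms to \<open>N\<close>.\<close>

lemma is_norm_ge_norm:
  fixes N :: "'a::euclidean_space \<Rightarrow> real"
  assumes "is_norm N"
  obtains c where "0 < c" "\<And>x. c * norm x \<le> N x"
proof -
  obtain u where u: "u \<in> sphere 0 1" and min: "\<And>x. x \<in> sphere 0 1 \<Longrightarrow> N u \<le> N x"
    using continuous_attains_inf[of "sphere (0::'a) 1" N] continuous_on_is_norm[OF assms]
    by auto
  have "N u \<noteq> 0"
    using assms u unfolding is_norm_def by auto
  then have "0 < N u"
    using is_norm_nonneg[OF assms, of u] by simp
  moreover have "N u * norm x \<le> N x" for x
  proof (cases "x = 0")
    case True
    then show ?thesis
      by (simp add: is_norm_nonneg[OF assms])
  next
    case False
    then have "N u \<le> N ((1 / norm x) *\<^sub>R x)"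
      by (intro min) simp
    also have "\<dots> = \<bar>1 / norm x\<bar> * N x"
      using assms unfolding is_norm_def by blast
    finally show ?thesis
      using False by (simp add: field_simps)
  qed
  ultimately show thesis
    by (rule that)
qed

lemma bounded_subsequence_or_norm_at_top:
  fixes a :: "nat \<Rightarrow> 'a::real_normed_vector"
  obtains s :: "nat \<Rightarrow> nat" where "strict_mono s" "bounded (range (a \<circ> s))"
  | "filterlim (\<lambda>n. norm (a n)) at_top sequentially"
proof (cases "filterlim (\<lambda>n. norm (a n)) at_top sequentially")
  case False
  \<comment> \<open>If the norms do not diverge, some bound \<open>B\<close> is undershot infinitely
    often; enumerating those indices yields the bounded subsequence.\<close>
  then obtain B where "\<not> (\<forall>\<^sub>F n in sequentially. B \<le> norm (a n))"
    unfolding filterlim_at_top by blast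
  then have inf: "infinite {n. norm (a n) < B}"
    by (simp add: not_eventually not_le frequently_cofinite flip: cofinite_eq_sequentially)
  show thesis
  proof (rule that(1))
    show "strict_mono (enumerate {n. norm (a n) < B})"
      using inf by (rule strict_mono_enumerate)
    show "bounded (range (a \<circ> enumerate {n. norm (a n) < B}))"
      using enumerate_in_set[OF inf] by (intro boundedI[of _ B]) (auto intro: less_imp_le)
  qed
qed (rule that(2))

text \<open>Fatou's lemma with both lower limits replaced by limits. Values lie in [0,\<infinity>],
  so \<open>g\<close> and \<open>l\<close> may be infinite; the divergent case below relies on
  this.\<close>

lemma nn_integral_le_LIMSEQ:
  fixes f :: "nat \<Rightarrow> 'a \<Rightarrow> ennreal"
  assumes "\<And>n. f n \<in> borel_measurable M"
    and "\<And>x. (\<lambda>n. f n x) \<longlonglongrightarrow> g x"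
    and "(\<lambda>n. \<integral>\<^sup>+x. f n x \<partial>M) \<longlonglongrightarrow> l"
  shows "(\<integral>\<^sup>+x. g x \<partial>M) \<le> l"
proof -
  have "(\<integral>\<^sup>+x. g x \<partial>M) = (\<integral>\<^sup>+x. liminf (\<lambda>n. f n x) \<partial>M)"
    by (simp add: lim_imp_Liminf[OF trivial_limit_sequentially assms(2)])
  also have "\<dots> \<le> liminf (\<lambda>n. \<integral>\<^sup>+x. f n x \<partial>M)"
    using assms(1) by (rule nn_integral_liminf)
  also have "\<dots> = l"
    using trivial_limit_sequentially assms(3) by (rule lim_imp_Liminf)
  finally show ?thesis .
qed

lemma norm_moment_attains_INF:
  fixes N :: "'a::euclidean_space \<Rightarrow> real"
  assumes N: "is_norm N" and r: "0 < r" and S: "closed S" "S \<noteq> {}"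
    and P: "prob_space P" "sets P = sets borel"
  obtains a where "a \<in> S"
    "(\<integral>\<^sup>+x. ennreal (N (x - a) powr r) \<partial>P) = (INF b\<in>S. \<integral>\<^sup>+x. ennreal (N (x - b) powr r) \<partial>P)"
proof -
  define G where "G a = (\<integral>\<^sup>+x. ennreal (N (x - a) powr r) \<partial>P)" for a
  define m where "m = (INF b\<in>S. G b)"
  \<comment> \<open>Fatou's lemma gives only this inequality; the reverse one holds because
    \<open>m\<close> is a lower bound.\<close>
  have "\<exists>a\<in>S. G a \<le> m"
  proof -
    have contN: "continuous_on UNIV N"
      using N by (rule continuous_on_is_norm)
    have meas: "(\<lambda>x. ennreal (N (x - a) powr r)) \<in> borel_measurable P" for a
    proof -
      have [measurable]: "N \<in> borel_measurable borel"
        using contN by (rule borel_measurable_continuous_onI)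
      have "(\<lambda>x. ennreal (N (x - a) powr r)) \<in> borel_measurable borel"
        by measurable
      then show ?thesis
        unfolding measurable_cong_sets[OF P(2) refl] .
    qed
    have "G ` S \<noteq> {}"
      using S(2) by simp
    \<comment> \<open>A decreasing sequence of attained values converges to its infimum
      \<open>m\<close>; choosing preimages in \<open>S\<close> gives the minimizing centers
      \<open>a n\<close>.\<close>
    then obtain g where g: "decseq g" "range g \<subseteq> G ` S" "m = (INF n. g n)"
      unfolding m_def using ennreal_Inf_countable_INF by metis
    have "\<forall>n. \<exists>b\<in>S. g n = G b"
      using g(2) by blast
    then obtain a where aS: "\<And>n. a n \<in> S" and ga: "\<And>n. g n = G (a n)"
      by metis
    have lim: "(\<lambda>n. G (a n)) \<longlonglongrightarrow> m"
      using LIMSEQ_INF[OF g(1), folded g(3)] by (simp only: ga[symmetric])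
    show ?thesis
    proof (cases rule: bounded_subsequence_or_norm_at_top[of a])
      case (1 s)
      then obtain l t where t: "strict_mono (t :: nat \<Rightarrow> nat)" and l: "((a \<circ> s) \<circ> t) \<longlonglongrightarrow> l"
        using bounded_imp_convergent_subsequence by blast
      have "l \<in> S"
        using S(1) _ l by (rule closed_sequentially) (simp add: aS)
      moreover have "G l \<le> m"
        unfolding G_def
      proof (rule nn_integral_le_LIMSEQ)
        have "strict_mono (s \<circ> t)"
          using 1(1) t by (rule strict_mono_o)
        from LIMSEQ_subseq_LIMSEQ[OF lim this]
        show "(\<lambda>n. \<integral>\<^sup>+x. ennreal (N (x - a (s (t n))) powr r) \<partial>P) \<longlonglongrightarrow> m"
          by (simp add: G_def o_def)
        show "(\<lambda>n. ennreal (N (x - a (s (t n))) powr r)) \<longlonglongrightarrow> ennreal (N (x - l) powr r)" for x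
        proof -
          have "isCont N (x - l)"
            using contN by (simp add: continuous_on_eq_continuous_at)
          moreover have "(\<lambda>n. x - a (s (t n))) \<longlonglongrightarrow> x - l"
            using l by (auto simp: o_def intro: tendsto_intros)
          ultimately have "(\<lambda>n. N (x - a (s (t n)))) \<longlonglongrightarrow> N (x - l)"
            by (rule isCont_tendsto_compose)
          then show ?thesis
            \<comment> \<open>The limit base is 0 when \<open>x = l\<close>; convergence of the
              powers there rests on \<open>0 < r\<close> and on nonnegative bases.\<close>
            using r is_norm_nonneg[OF N] by (intro tendsto_ennrealI tendsto_powr') auto
        qed
      qed (rule meas)
      ultimately show ?thesis by blast
    next
      case 2
      obtain c where c: "0 < c" "\<And>x. c * norm x \<le> N x"
        using is_norm_ge_norm[OF N] by blast
      \<comment> \<open>For each fixed \<open>x\<close> the centers recede from \<open>x\<close>, so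
        the integrands tend to \<infinity> pointwise and Fatou's lemma applies with the constant
        limit \<infinity>.\<close>
      have "(\<integral>\<^sup>+x. \<infinity> \<partial>P) \<le> m"
      proof (rule nn_integral_le_LIMSEQ)
        show "(\<lambda>n. \<integral>\<^sup>+x. ennreal (N (x - a n) powr r) \<partial>P) \<longlonglongrightarrow> m"
          using lim by (simp add: G_def)
        show "(\<lambda>n. ennreal (N (x - a n) powr r)) \<longlonglongrightarrow> \<infinity>" for x
        proof -
          have "filterlim (\<lambda>n. - norm x + norm (a n)) at_top sequentially"
            using 2 by (rule filterlim_tendsto_add_at_top[OF tendsto_const])
          then have "filterlim (\<lambda>n. c * (- norm x + norm (a n))) at_top sequentially"
            by (rule filterlim_tendsto_pos_mult_at_top[OF tendsto_const c(1)])
          moreover have "c * (- norm x + norm (a n)) \<le> N (x - a n)" for n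
          proof -
            have "- norm x + norm (a n) \<le> norm (x - a n)"
              by norm
            then have "c * (- norm x + norm (a n)) \<le> c * norm (x - a n)"
              using c(1) by simp
            also have "\<dots> \<le> N (x - a n)"
              by (rule c(2))
            finally show ?thesis .
          qed
          ultimately have "filterlim (\<lambda>n. N (x - a n)) at_top sequentially"
            by (auto intro: filterlim_at_top_mono)
          then have "filterlim (\<lambda>n. N (x - a n) powr r) at_top sequentially"
            by (rule filterlim_compose[OF real_powr_at_top[OF r]])
          then show ?thesis
            by (simp add: ennreal_tendsto_top_eq_at_top)
        qed
      qed (rule meas)
      \<comment> \<open>Total mass 1 makes the integral of the constant \<infinity> infinite. Then
        \<open>G a \<le> m\<close> is trivial for any point of the nonempty set
        \<open>S\<close>.\<close>
      then have "m = \<infinity>"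
        using prob_space.emeasure_space_1[OF P(1)] by (simp add: top_unique)
      then show ?thesis
        using S(2) by auto
    qed
  qed
  then obtain a where "a \<in> S" "G a \<le> m" by blast
  moreover from this have "m \<le> G a"
    unfolding m_def by (intro INF_lower)
  ultimately show thesis
    using that unfolding m_def G_def by (meson antisym)
qed

lemma distortion_singleton: "distortion d r P {a} = (\<integral>\<^sup>+x. ennreal (d x a powr r) \<partial>P)"
  by (simp add: distortion_def)

text \<open>The admissible sets are exactly the singletons of points of \<open>S\<close>, which
  turns the problem into the minimization over centers solved by
  \<open>norm_moment_attains_INF\<close>.\<close>

lemma quantization_error_1: "quantization_error d r P S 1 = (INF a\<in>S. distortion d r P {a})"
proof -
  have "1 \<le> card A \<and> card A \<le> 1 \<longleftrightarrow> (\<exists>a. A = {a})" for A :: "'a set"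
    using card_1_singleton_iff[of A] by auto
  then have "{A. A \<subseteq> S \<and> 1 \<le> card A \<and> card A \<le> 1} = (\<lambda>a. {a}) ` S"
    by auto
  then show ?thesis
    by (simp add: quantization_error_def image_image)
qed

theorem proposition1p3:
  fixes N :: "real ^ 'k \<Rightarrow> real" and r :: real
    and S :: "(real ^ 'k) set" and P :: "(real ^ 'k) measure"
  assumes "is_norm N"
    and "0 < r"
    and "closed S" and "S \<noteq> {}"
    and "prob_space P" and "sets P = sets borel"
    and "(\<integral>\<^sup>+ x. ennreal (norm_metric N x 0 powr r) \<partial>P) < \<infinity>"
  shows "optimal_sets (norm_metric N) r P S 1 \<noteq> {}"
proof -
  obtain a where "a \<in> S"
    "distortion (norm_metric N) r P {a} = quantization_error (norm_metric N) r P S 1"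
    using norm_moment_attains_INF[OF assms(1-6)]
    unfolding quantization_error_1 distortion_singleton norm_metric_def by blast
  then have "{a} \<in> optimal_sets (norm_metric N) r P S 1"
    by (simp add: optimal_sets_def)
  then show ?thesis by blast
qed

end
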